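(* Let $X\subseteq Q_n$ be a proper cubical complex of dimension $d$, and let $\mathbf{P}X\subseteq Q_{n+1}$ be the prism over $X$. Then $$E^{\rm tot}(\mathbf{P}X;r,t)=(1+r^2+tr^2)\,E^{\rm tot}(X;r,t),$$ and for all $0\le i\le d$: $$E^{\rm tot}_i(\mathbf{P}X;r)=(1+r^2)E^{\rm tot}_i(X;r)+r^2E^{\rm tot}_{i-1}(X;r),$$ $$s^{\rm tot}_i(\mathbf{P}X)=\{\lambda : \lambda\in s^{\rm tot}_i(X)\}\cup\{\lambda+2 : \lambda\in s^{\rm tot}_i(X)\}\cup\{\mu+2 : \mu\in s^{\rm tot}_{i-1}(X)\},$$ $$s^{\rm ud}_i(\mathbf{P}X)\overset{\circ}{=}\{\lambda : \lambda\in s^{\rm ud}_i(X)\}\cup\{\lambda+2 : \lambda\in s^{\rm tot}_i(X)\},$$ where $\cup$ denotes multiset union and $\overset{\circ}{=}$ means that two multisets are equal up to the multiplicity of the element $0$. In particular, the prism operation preserves Laplacian integrality.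
   Context: The $n$-cube $Q_n$ is the poset of $n$-tuples $f=(f_1,\dots,f_n)$ with $f_i\in\{0,1,\circledast\}$, ordered by $f\le g$ iff $f_i\le g_i$ for all $i$, where $0<\circledast$, $1<\circledast$, and $0,1$ are incomparable. These are the nonempty faces of the unit cube in $\mathbb{R}^n$ ($\circledast$ stands for the open interval $(0,1)$). The direction of $f$ is $\mathrm{dir}(f)=\{i : f_i=\circledast\}$ and $\dim f=|\mathrm{dir}(f)|$. A proper cubical complex is a nonempty order ideal $X$ of some $Q_n$; $X_i$ is its set of $i$-dimensional faces (there is no $(-1)$-dimensional face). For $f\le g$ with $\dim f=i-1$, $\dim g=i$, write $\mathrm{dir}(g)=\{a_1<\dots<a_i\}$ and $\mathrm{dir}(f)=\mathrm{dir}(g)\setminus\{a_j\}$; put $\varepsilon(f,g)=(-1)^j$ if $f_{a_j}=0$ and $\varepsilon(f,g)=(-1)^{j+1}$ if $f_{a_j}=1$. If $f\not\le g$, put $\varepsilon(f,g)=0$. The boundary map $\partial_{X,i}\colon C_i(X)\to C_{i-1}(X)$ ($C_i(X)$ the free module on $X_i$) is $[g]\mapsto\sum_{f\in X_{i-1}}\varepsilon(f,g)[f]$, with $\partial_{X,0}=0$, and $\partial^*_{X,i}$ is its transpose. The Laplacians on $C_i(X)$ are $$L^{\rm ud}_{X,i}=\partial_{X,i+1}\partial^*_{X,i+1},\quad L^{\rm du}_{X,i}=\partial^*_{X,i}\partial_{X,i},\quad L^{\rm tot}_{X,i}=L^{\rm ud}_{X,i}+L^{\rm du}_{X,i},$$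 and $s^{\rm ud}_i(X),s^{\rm du}_i(X),s^{\rm tot}_i(X)$ are the multisets of their eigenvalues ($s^{\rm tot}_{-1}(X)=\emptyset$). Put $E^{\rm tot}_i(X;r)=\sum_{\lambda\in s^{\rm tot}_i(X)}r^\lambda$ (so $E^{\rm tot}_{-1}=0$) and $E^{\rm tot}(X;r,t)=\sum_{i=0}^{\dim X}t^iE^{\rm tot}_i(X;r)$. A complex is Laplacian integral if all eigenvalues of all its Laplacians are integers. The prism over $X\subseteq Q_n$ is $\mathbf{P}X=\{(f_1,\dots,f_{n+1})\in Q_{n+1} : (f_1,\dots,f_n)\in X\}$. *)

theory Defs
  imports
    Complex_Main
    "HOL-Library.Multiset"
    "HOL-Library.Poly_Mapping"
    "HOL-Computational_Algebra.Polynomial"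
    "Jordan_Normal_Form.Char_Poly"
begin

section \<open>Faces of the cube\<close>

datatype coord = Zero | One | Star

text \<open>
  A face is the list of its coordinates. Positions are counted from 0 rather than from 1;
  only their relative order enters the incidence signs below.
\<close>

type_synonym face = "coord list"

definition coord_le :: "coord \<Rightarrow> coord \<Rightarrow> bool" where
  "coord_le x y \<longleftrightarrow> x = y \<or> y = Star"

definition face_le :: "face \<Rightarrow> face \<Rightarrow> bool" where
  "face_le f g \<longleftrightarrow> list_all2 coord_le f g"

definition cube :: "nat \<Rightarrow> face set" where
  "cube n = {f. length f = n}"

definition dir :: "face \<Rightarrow> nat set" where
  "dir f = {k. k < length f \<and> f ! k = Star}"

definition face_dim :: "face \<Rightarrow> nat" where
  "face_dim f = card (dir f)"

definition cubical_complex :: "nat \<Rightarrow> face set \<Rightarrow> bool" where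
  "cubical_complex n X \<longleftrightarrow>
     X \<subseteq> cube n \<and> X \<noteq> {} \<and> (\<forall>g\<in>X. \<forall>f\<in>cube n. face_le f g \<longrightarrow> f \<in> X)"

definition complex_dim :: "face set \<Rightarrow> nat" where
  "complex_dim X = Max (face_dim ` X)"

definition prism :: "nat \<Rightarrow> face set \<Rightarrow> face set" where
  "prism n X = {f \<in> cube (Suc n). take n f \<in> X}"


section \<open>Boundary maps and Laplacians\<close>

text \<open>
  The sign uses the position \<open>a\<close> with \<open>dir f = dir g - {a}\<close> and its rank \<open>j\<close>
  (starting at 1) in the increasing enumeration of \<open>dir g\<close>.
\<close>

definition incidence :: "face \<Rightarrow> face \<Rightarrow> int" where
  "incidence f g =
     (if face_le f g \<and> face_dim g = Suc (face_dim f) then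
        (let a = (THE a. a \<in> dir g \<and> dir f = dir g - {a});
             j = card {b \<in> dir g. b \<le> a}
         in if f ! a = Zero then (-1) ^ j else (-1) ^ (j + 1))
      else 0)"

text \<open>
  The faces of \<open>X \<subseteq> cube n\<close> of dimension \<open>i\<close>, listed in a fixed order without repetition;
  this list is the basis with respect to which all matrices are written.
  Dimensions are integers, so that there are no faces in dimension \<open>-1\<close>. Accordingly the
  boundary matrix in dimension 0 has no rows, and the Laplacian in dimension \<open>-1\<close> is the
  \<open>0 \<times> 0\<close> matrix, whose multiset of eigenvalues is empty.
\<close>

definition faces :: "nat \<Rightarrow> face set \<Rightarrow> int \<Rightarrow> face list" where
  "faces n X i =
     filter (\<lambda>f. f \<in> X \<and> int (face_dim f) = i) (List.n_lists n [Zero, One, Star])"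

definition boundary :: "nat \<Rightarrow> face set \<Rightarrow> int \<Rightarrow> int mat" where
  "boundary n X i =
     mat (length (faces n X (i - 1))) (length (faces n X i))
       (\<lambda>(p, q). incidence (faces n X (i - 1) ! p) (faces n X i ! q))"

definition L_ud :: "nat \<Rightarrow> face set \<Rightarrow> int \<Rightarrow> int mat" where
  "L_ud n X i = boundary n X (i + 1) * transpose_mat (boundary n X (i + 1))"

definition L_du :: "nat \<Rightarrow> face set \<Rightarrow> int \<Rightarrow> int mat" where
  "L_du n X i = transpose_mat (boundary n X i) * boundary n X i"

definition L_tot :: "nat \<Rightarrow> face set \<Rightarrow> int \<Rightarrow> int mat" where
  "L_tot n X i = L_ud n X i + L_du n X i"


section \<open>Spectra\<close>

text \<open>
  Eigenvalues with algebraic multiplicity, taken over the complex numbers, so that an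
  \<open>m \<times> m\<close> matrix has exactly \<open>m\<close> of them. Those of the (symmetric) Laplacians are real.
\<close>

definition eigenvalues :: "int mat \<Rightarrow> complex multiset" where
  "eigenvalues A = proots (char_poly (map_mat of_int A :: complex mat))"

definition s_ud :: "nat \<Rightarrow> face set \<Rightarrow> int \<Rightarrow> complex multiset" where
  "s_ud n X i = eigenvalues (L_ud n X i)"

definition s_du :: "nat \<Rightarrow> face set \<Rightarrow> int \<Rightarrow> complex multiset" where
  "s_du n X i = eigenvalues (L_du n X i)"

definition s_tot :: "nat \<Rightarrow> face set \<Rightarrow> int \<Rightarrow> complex multiset" where
  "s_tot n X i = eigenvalues (L_tot n X i)"

definition eq_upto_zero :: "complex multiset \<Rightarrow> complex multiset \<Rightarrow> bool"
    (infix "\<doteq>" 50) where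
  "A \<doteq> B \<longleftrightarrow> (\<forall>x. x \<noteq> 0 \<longrightarrow> count A x = count B x)"

definition laplacian_integral :: "nat \<Rightarrow> face set \<Rightarrow> bool" where
  "laplacian_integral n X \<longleftrightarrow>
     (\<forall>i. \<forall>x. x \<in># s_ud n X i \<or> x \<in># s_du n X i \<or> x \<in># s_tot n X i \<longrightarrow> x \<in> \<int>)"


section \<open>Generating functions\<close>

text \<open>
  Eigenvalues need not be integers, so generating functions in \<open>r\<close> live in the ring of formal
  finite sums of powers \<open>r\<^sup>a\<close> with integer coefficients, multiplied by
  \<open>r\<^sup>a * r\<^sup>b = r\<^bsup>a+b\<^esup>\<close>. Generating functions in \<open>r\<close> and \<open>t\<close> are polynomials in
  \<open>t\<close> over this ring.
\<close>

type_synonym genfun = "complex \<Rightarrow>\<^sub>0 int"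

definition rpow :: "complex \<Rightarrow> genfun" where
  "rpow a = Poly_Mapping.single a 1"

definition E_tot :: "nat \<Rightarrow> face set \<Rightarrow> int \<Rightarrow> genfun" where
  "E_tot n X i = (\<Sum>x\<in>#s_tot n X i. rpow x)"

definition E_tot_poly :: "nat \<Rightarrow> face set \<Rightarrow> genfun poly" where
  "E_tot_poly n X = (\<Sum>i=0..complex_dim X. Polynomial.monom (E_tot n X (int i)) i)"

end

theory Submission
  imports Defs
begin

text \<open>
  An \<open>i\<close>-dimensional face of the prism is a bottom face \<open>f @ [Zero]\<close> or a top face \<open>f @ [One]\<close> with
  \<open>f\<close> in \<open>X\<close> of dimension \<open>i\<close>, or a vertical face \<open>c @ [Star]\<close> with \<open>c\<close> in \<open>X\<close> of dimension \<open>i - 1\<close>.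
  Write \<open>U\<close> for the up-down Laplacian of \<open>X\<close> in dimension \<open>i\<close>, \<open>V\<close> for the down-up Laplacian in
  dimension \<open>i - 1\<close>, \<open>F\<close> for \<open>(-1) ^ (i + 1)\<close> times the boundary map from dimension \<open>i\<close>, and \<open>E\<close>
  for the transpose of \<open>F\<close>. Thus \<open>E F\<close> is the down-up Laplacian in dimension \<open>i\<close> and \<open>F E\<close> the
  up-down Laplacian in dimension \<open>i - 1\<close>. The incidence numbers show that with respect to these three
  groups of faces the Laplacians of the prism in dimension \<open>i\<close> are

    up-down: \<open>((U + 1, -1, E), (-1, U + 1, - E), (F, - F, F E))\<close>,

    down-up: \<open>((E F, 0, - E), (0, E F, E), (- F, F, V + 2))\<close>.

  In their sum the off-diagonal blocks \<open>E\<close> and \<open>F\<close> cancel. With \<open>L = U + E F\<close> and \<open>L' = V + F E\<close>, the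
  total Laplacians of \<open>X\<close> in dimensions \<open>i\<close> and \<open>i - 1\<close>, the sum acts as \<open>L\<close> on the vectors \<open>(v, v, 0)\<close>,
  as \<open>L + 2\<close> on the vectors \<open>(v, - v, 0)\<close>, and as \<open>L' + 2\<close> on the vectors \<open>(0, 0, c)\<close>. This gives the
  total spectrum (\<open>s_tot_prism\<close>) and, by summing powers, both statements on generating functions.

  For the up-down Laplacian the vectors \<open>(v, v, 0)\<close> carry \<open>U\<close>, and since \<open>F U = 0\<close> (the boundary of a
  boundary vanishes) the vectors \<open>(v, - v, F v)\<close> carry \<open>L + 2\<close>; modulo these the matrix is zero. So the
  spectrum is that of \<open>U\<close>, that of \<open>L\<close> shifted by 2, and zeros (\<open>s_ud_prism\<close>). In the same way
  \<open>E V = 0\<close> gives the down-up spectrum: that of \<open>E F\<close>, that of \<open>L'\<close> shifted by 2, and zeros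
  (\<open>s_du_prism\<close>). All three spectra are therefore integral if those of \<open>X\<close> are.

  All these subspaces can be split off one after the other as graphs of linear maps between blocks, so
  that the spectra follow from the lemma \<open>char_poly_invariant_graph\<close> on 2 by 2 block matrices.
\<close>

section \<open>Characteristic polynomials of block matrices\<close>

lemma char_poly_four_block_lower_left_zero:
  fixes A :: "'a :: idom mat"
  assumes A: "A \<in> carrier_mat n n" and B: "B \<in> carrier_mat n m" and D: "D \<in> carrier_mat m m"
  shows "char_poly (four_block_mat A B (0\<^sub>m m n) D) = char_poly A * char_poly D"
proof -
  let ?cm = "\<lambda>A. [:0, 1:] \<cdot>\<^sub>m 1\<^sub>m (dim_row A) + map_mat (\<lambda>a. [:- a:]) A"
  have "?cm (four_block_mat A B (0\<^sub>m m n) D)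
      = four_block_mat (?cm A) (map_mat (\<lambda>a. [:- a:]) B) (0\<^sub>m m n) (?cm D)"
    by (rule eq_matI) (use A B D in \<open>auto simp: one_poly_def\<close>)
  moreover have "det \<dots> = det (?cm A) * det (?cm D)"
    by (rule det_four_block_mat_lower_left_zero) (use A B D in auto)
  ultimately show ?thesis
    unfolding char_poly_defs by simp
qed

lemma uminus_zero_mat [simp]: "- 0\<^sub>m n m = (0\<^sub>m n m :: 'a :: group_add mat)"
  by (rule eq_matI) auto

lemma cancel_mat:
  fixes A :: "'a :: ab_group_add mat"
  assumes "A \<in> carrier_mat n m" "B \<in> carrier_mat n m"
  shows "A + (B - A) = B" "B + A + - A = B" "A + - A = 0\<^sub>m n m" "- A + A = 0\<^sub>m n m"
  by (rule eq_matI; use assms in auto)+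

text \<open>
  The condition says that the graph \<open>{(v, X v)}\<close> is mapped into itself. The matrix acts on the graph
  as \<open>A + B X\<close>, and on the quotient by the graph, with the second component as coordinate after
  subtracting \<open>X\<close> times the first, as \<open>D - X B\<close>.
\<close>
lemma char_poly_invariant_graph:
  fixes A :: "'a :: idom mat"
  assumes A: "A \<in> carrier_mat n n" and B: "B \<in> carrier_mat n m"
    and C: "C \<in> carrier_mat m n" and D: "D \<in> carrier_mat m m" and X: "X \<in> carrier_mat m n"
    and inv: "C + D * X = X * (A + B * X)"
  shows "char_poly (four_block_mat A B C D) = char_poly (A + B * X) * char_poly (D - X * B)"
proof -
  let ?P = "four_block_mat (1\<^sub>m n) (0\<^sub>m n m) X (1\<^sub>m m)"
  let ?Q = "four_block_mat (1\<^sub>m n) (0\<^sub>m n m) (- X) (1\<^sub>m m)"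
  let ?T = "four_block_mat (A + B * X) B (0\<^sub>m m n) (D - X * B)"
  have c: "B * X \<in> carrier_mat n n" "X * B \<in> carrier_mat m m" "D * X \<in> carrier_mat m n"
      "A + B * X \<in> carrier_mat n n" "- X \<in> carrier_mat m n"
      "D - X * B \<in> carrier_mat m m"
    using A B C D X by auto
  have neg: "B * (- X) = - (B * X)" "D * (- X) = - (D * X)"
    using B D X by simp_all
  have one: "four_block_mat (1\<^sub>m n) (0\<^sub>m n m) (0\<^sub>m m n) (1\<^sub>m m) = (1\<^sub>m (n + m) :: 'a mat)"
    by simp
  have "?P * ?Q = four_block_mat (1\<^sub>m n) (0\<^sub>m n m) (X + - X) (1\<^sub>m m)"
    by (subst mult_four_block_mat[where ?nr1.0 = n and ?nr2.0 = m and ?nc1.0 = n and ?nc2.0 = m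
        and ?n1.0 = n and ?n2.0 = m]) (use X c in simp_all)
  also have "X + - X = 0\<^sub>m m n" using cancel_mat[OF X X] by simp
  finally have PQ: "?P * ?Q = 1\<^sub>m (n + m)" using one by simp
  have "?Q * ?P = four_block_mat (1\<^sub>m n) (0\<^sub>m n m) (- X + X) (1\<^sub>m m)"
    by (subst mult_four_block_mat[where ?nr1.0 = n and ?nr2.0 = m and ?nc1.0 = n and ?nc2.0 = m
        and ?n1.0 = n and ?n2.0 = m]) (use X c in simp_all)
  also have "- X + X = 0\<^sub>m m n" using cancel_mat[OF X X] by simp
  finally have QP: "?Q * ?P = 1\<^sub>m (n + m)" using one by simp
  have "?P * ?T = four_block_mat (A + B * X) B (X * (A + B * X)) (X * B + (D - X * B))"
    by (subst mult_four_block_mat[where ?nr1.0 = n and ?nr2.0 = m and ?nc1.0 = n and ?nc2.0 = m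
        and ?n1.0 = n and ?n2.0 = m]) (use A B D X c in simp_all)
  also have "X * B + (D - X * B) = D" using cancel_mat[OF c(2) D] by simp
  also have "four_block_mat (A + B * X) B (X * (A + B * X)) D * ?Q
      = four_block_mat (A + B * X + B * (- X)) B (X * (A + B * X) + D * (- X)) D"
    by (subst mult_four_block_mat[where ?nr1.0 = n and ?nr2.0 = m and ?nc1.0 = n and ?nc2.0 = m
        and ?n1.0 = n and ?n2.0 = m]) (use A B D X c in simp_all)
  also have "A + B * X + B * (- X) = A"
    unfolding neg using cancel_mat[OF c(1) A] by simp
  also have "X * (A + B * X) + D * (- X) = C"
    unfolding inv[symmetric] neg using cancel_mat[OF c(3) C] by simp
  finally have PTQ: "?P * ?T * ?Q = four_block_mat A B C D" .
  have "{four_block_mat A B C D, ?T, ?P, ?Q} \<subseteq> carrier_mat (n + m) (n + m)"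
    using A D X c by simp
  then have "similar_mat (four_block_mat A B C D) ?T"
    by (rule similar_matI[OF _ PQ QP PTQ[symmetric]])
  then have "char_poly (four_block_mat A B C D) = char_poly ?T"
    by (rule char_poly_similar)
  also have "\<dots> = char_poly (A + B * X) * char_poly (D - X * B)"
    using char_poly_four_block_lower_left_zero[OF c(4) B c(6)] .
  finally show ?thesis .
qed

lemma four_block_mat_zero_dims:
  assumes "A \<in> carrier_mat n m"
  shows "four_block_mat A (0\<^sub>m n 0) (0\<^sub>m 0 m) (0\<^sub>m 0 0) = A"
  by (rule eq_matI) (use assms in auto)

text \<open>
  The shape shared by all Laplacians of a prism: the first two blocks stand for bottom and top and may
  be exchanged, up to a sign on the third block. The vectors \<open>(v, v, 0)\<close> are mapped to vectors of the
  same kind, through \<open>M0 + M1\<close>, and the second factor is the action on the quotient by them. A block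
  matrix of shape 1 by 2 or 2 by 1 is written as a 2 by 2 block matrix with empty blocks.
\<close>
lemma char_poly_swap_symmetric:
  fixes M0 :: "'a :: idom mat"
  assumes M0: "M0 \<in> carrier_mat n n" and M1: "M1 \<in> carrier_mat n n"
    and E: "E \<in> carrier_mat n k" and F: "F \<in> carrier_mat k n" and Z: "Z \<in> carrier_mat k k"
  shows "char_poly (four_block_mat M0 (four_block_mat M1 E (0\<^sub>m 0 n) (0\<^sub>m 0 k))
            (four_block_mat M1 (0\<^sub>m n 0) F (0\<^sub>m k 0)) (four_block_mat M0 (- E) (- F) Z))
       = char_poly (M0 + M1) * char_poly (four_block_mat (M0 - M1) (- E - E) (- F) Z)"
proof -
  let ?B = "four_block_mat M1 E (0\<^sub>m 0 n) (0\<^sub>m 0 k)"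
  let ?C = "four_block_mat M1 (0\<^sub>m n 0) F (0\<^sub>m k 0)"
  let ?D = "four_block_mat M0 (- E) (- F) Z"
  let ?X = "four_block_mat (1\<^sub>m n) (0\<^sub>m n 0) (0\<^sub>m k n) (0\<^sub>m k 0) :: 'a mat"
  have carr: "?B \<in> carrier_mat n (n + k)" "?C \<in> carrier_mat (n + k) n"
      "?D \<in> carrier_mat (n + k) (n + k)" "?X \<in> carrier_mat (n + k) n"
    using assms by auto
  have "?B * ?X = four_block_mat M1 (0\<^sub>m n 0) (0\<^sub>m 0 n) (0\<^sub>m 0 0)"
    by (subst mult_four_block_mat[where ?nr1.0 = n and ?nr2.0 = 0 and ?nc1.0 = n and ?nc2.0 = 0
        and ?n1.0 = n and ?n2.0 = k]) (use assms in auto)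
  also have "\<dots> = M1" using four_block_mat_zero_dims[OF M1] .
  finally have BX: "?B * ?X = M1" .
  have DX: "?D * ?X = four_block_mat M0 (0\<^sub>m n 0) (- F) (0\<^sub>m k 0)"
    by (subst mult_four_block_mat[where ?nr1.0 = n and ?nr2.0 = k and ?nc1.0 = n and ?nc2.0 = 0
        and ?n1.0 = n and ?n2.0 = k]) (use assms in auto)
  have XB: "?X * ?B = four_block_mat M1 E (0\<^sub>m k n) (0\<^sub>m k k)"
    by (subst mult_four_block_mat[where ?nr1.0 = n and ?nr2.0 = k and ?nc1.0 = n and ?nc2.0 = k
        and ?n1.0 = n and ?n2.0 = 0]) (use assms in auto)
  have "?C + ?D * ?X = four_block_mat (M0 + M1) (0\<^sub>m n 0) (0\<^sub>m k n) (0\<^sub>m k 0)"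
    unfolding DX by (rule eq_matI) (use assms in auto)
  also have "\<dots> = ?X * four_block_mat (M0 + M1) (0\<^sub>m n 0) (0\<^sub>m 0 n) (0\<^sub>m 0 0)"
    by (subst mult_four_block_mat[where ?nr1.0 = n and ?nr2.0 = k and ?nc1.0 = n and ?nc2.0 = 0
        and ?n1.0 = n and ?n2.0 = 0]) (use assms in auto)
  also have "four_block_mat (M0 + M1) (0\<^sub>m n 0) (0\<^sub>m 0 n) (0\<^sub>m 0 0) = M0 + M1"
    by (rule four_block_mat_zero_dims) (use M0 M1 in auto)
  finally have "?C + ?D * ?X = ?X * (M0 + ?B * ?X)" unfolding BX .
  from char_poly_invariant_graph[OF M0 carr this]
  have "char_poly (four_block_mat M0 ?B ?C ?D) = char_poly (M0 + M1) * char_poly (?D - ?X * ?B)"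
    unfolding BX .
  also have "?D - ?X * ?B = four_block_mat (M0 - M1) (- E - E) (- F) Z"
    unfolding XB by (rule eq_matI) (use assms in auto)
  finally show ?thesis .
qed

text \<open>
  Lets the invariant-graph argument be used also for graphs over the second component.
\<close>
lemma char_poly_four_block_swap:
  fixes A :: "'a :: idom mat"
  assumes A: "A \<in> carrier_mat n n" and B: "B \<in> carrier_mat n m"
    and C: "C \<in> carrier_mat m n" and D: "D \<in> carrier_mat m m"
  shows "char_poly (four_block_mat A B C D) = char_poly (four_block_mat D C B A)"
proof -
  let ?P = "four_block_mat (0\<^sub>m n m) (1\<^sub>m n) (1\<^sub>m m) (0\<^sub>m m n) :: 'a mat"
  let ?Q = "four_block_mat (0\<^sub>m m n) (1\<^sub>m m) (1\<^sub>m n) (0\<^sub>m n m) :: 'a mat"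
  have PQ: "?P * ?Q = 1\<^sub>m (n + m)"
    by (subst mult_four_block_mat[where ?nr1.0 = n and ?nr2.0 = m and ?nc1.0 = n and ?nc2.0 = m
        and ?n1.0 = m and ?n2.0 = n]) auto
  have QP: "?Q * ?P = 1\<^sub>m (n + m)"
    by (subst mult_four_block_mat[where ?nr1.0 = m and ?nr2.0 = n and ?nc1.0 = m and ?nc2.0 = n
        and ?n1.0 = n and ?n2.0 = m]) (auto simp: add.commute)
  have "?P * four_block_mat D C B A = four_block_mat B A D C"
    by (subst mult_four_block_mat[where ?nr1.0 = n and ?nr2.0 = m and ?nc1.0 = m and ?nc2.0 = n
        and ?n1.0 = m and ?n2.0 = n]) (use assms in auto)
  also have "\<dots> * ?Q = four_block_mat A B C D"
    by (subst mult_four_block_mat[where ?nr1.0 = n and ?nr2.0 = m and ?nc1.0 = n and ?nc2.0 = m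
        and ?n1.0 = m and ?n2.0 = n]) (use assms in auto)
  finally have PMQ: "four_block_mat A B C D = ?P * four_block_mat D C B A * ?Q" ..
  have "{four_block_mat A B C D, four_block_mat D C B A, ?P, ?Q} \<subseteq> carrier_mat (n + m) (n + m)"
    using assms by (auto simp: add.commute)
  from similar_matI[OF this PQ QP PMQ] show ?thesis
    by (rule char_poly_similar)
qed

lemma char_poly_zero_mat: "char_poly (0\<^sub>m n n :: 'a :: idom mat) = [:0, 1:] ^ n"
proof -
  have "char_poly (0\<^sub>m n n :: 'a mat) = (\<Prod>a\<leftarrow>diag_mat (0\<^sub>m n n :: 'a mat). [:- a, 1:])"
    by (rule char_poly_upper_triangular[of _ n]) auto
  also have "map (\<lambda>a. [:- a, 1:]) (diag_mat (0\<^sub>m n n :: 'a mat)) = replicate n [:0, 1:]"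
    by (rule nth_equalityI) (auto simp: diag_mat_def)
  finally show ?thesis by simp
qed

lemma char_poly_add_scalar:
  fixes A :: "'a :: comm_ring_1 mat"
  assumes A: "A \<in> carrier_mat n n"
  shows "char_poly (A + c \<cdot>\<^sub>m 1\<^sub>m n) = pcompose (char_poly A) [:- c, 1:]"
proof -
  have "char_poly_matrix (A + c \<cdot>\<^sub>m 1\<^sub>m n) = map_mat (\<lambda>p. pcompose p [:- c, 1:]) (char_poly_matrix A)"
    by (rule eq_matI) (use A in \<open>auto simp: char_poly_matrix_def pcompose_pCons\<close>)
  then show ?thesis
    unfolding char_poly_def by (simp only: comm_ring_hom.hom_det[OF pcompose_hom.comm_ring_hom_axioms])
qed

section \<open>Multisets of eigenvalues\<close>

definition mset_spectrum :: "complex mat \<Rightarrow> complex multiset" where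
  "mset_spectrum A = proots (char_poly A)"

lemma eigenvalues_mset_spectrum: "eigenvalues M = mset_spectrum (map_mat of_int M)"
  by (simp add: eigenvalues_def mset_spectrum_def)

lemma proots_linear_factors: "proots (\<Prod>a\<leftarrow>as. [:- a, 1:]) = mset (as :: complex list)"
proof (induction as)
  case (Cons a as)
  have "(\<Prod>a\<leftarrow>as. [:- a, 1:]) \<noteq> 0"
    by (auto simp: prod_list_zero_iff)
  then show ?case
    using Cons proots_mult[of "[:- a, 1:]" "\<Prod>a\<leftarrow>as. [:- a, 1:]"]
    by (simp del: mult_pCons_left)
qed simp

lemma mset_spectrum_add_scalar:
  assumes A: "A \<in> carrier_mat n n"
  shows "mset_spectrum (A + c \<cdot>\<^sub>m 1\<^sub>m n) = image_mset (\<lambda>x. x + c) (mset_spectrum A)"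
proof -
  obtain as where as: "char_poly A = (\<Prod>a\<leftarrow>as. [:- a, 1:])"
    using char_poly_factorized[OF A] by blast
  have "pcompose (\<Prod>a\<leftarrow>as. [:- a, 1:]) [:- c, 1:] = (\<Prod>a\<leftarrow>map (\<lambda>a. a + c) as. [:- a, 1:])"
    for as :: "complex list"
    by (induction as) (simp_all add: pcompose_mult pcompose_pCons o_def algebra_simps del: mult_pCons_left)
  then have "char_poly (A + c \<cdot>\<^sub>m 1\<^sub>m n) = (\<Prod>a\<leftarrow>map (\<lambda>a. a + c) as. [:- a, 1:])"
    unfolding char_poly_add_scalar[OF A] as by simp
  then show ?thesis
    unfolding mset_spectrum_def as proots_linear_factors by (simp only: proots_linear_factors mset_map)
qed

lemma char_poly_nonzero: "A \<in> carrier_mat n n \<Longrightarrow> char_poly (A :: 'a :: idom mat) \<noteq> 0"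
  using degree_monic_char_poly[of A n] by auto

lemma mset_spectrum_zero_mat: "mset_spectrum (0\<^sub>m n n) = replicate_mset n 0"
  unfolding mset_spectrum_def char_poly_zero_mat by (simp add: proots_power)

lemma mset_spectrum_mult_char_poly:
  assumes "char_poly A = char_poly B * char_poly C * char_poly D"
    "B \<in> carrier_mat n n" "C \<in> carrier_mat m m" "D \<in> carrier_mat k k"
  shows "mset_spectrum A = mset_spectrum B + mset_spectrum C + mset_spectrum D"
  using assms(2-4)[THEN char_poly_nonzero] unfolding mset_spectrum_def assms(1) by (simp add: proots_mult)

section \<open>Spectra of the three block matrices\<close>

lemma add_right_commute_mat:
  fixes A :: "'a :: ab_semigroup_add mat"
  assumes "A \<in> carrier_mat n m" "B \<in> carrier_mat n m" "C \<in> carrier_mat n m"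
  shows "A + B + C = A + C + B"
  by (rule eq_matI) (use assms in \<open>auto simp: ac_simps\<close>)

lemma minus_zero_mat:
  assumes "(A :: 'a :: group_add mat) \<in> carrier_mat n m"
  shows "A - 0\<^sub>m n m = A"
  by (rule eq_matI) (use assms in auto)

lemma half_mat:
  fixes G :: "'a :: field_char_0 mat"
  assumes "G \<in> carrier_mat n m"
  shows "(- 1 / 2) \<cdot>\<^sub>m (- G - G) = G"
  by (rule eq_matI) (use assms in \<open>auto simp: field_simps\<close>)

text \<open>
  For a complex with up-down Laplacian \<open>U\<close>, signed boundary \<open>F\<close> and transpose \<open>E\<close>, this matrix is the
  up-down Laplacian of the prism. The vectors \<open>(v, v, 0)\<close> carry \<open>U\<close> and the vectors \<open>(v, - v, F v)\<close>
  carry \<open>U + E F + 2\<close>; the vanishing of \<open>F U\<close>, which is the equation of a chain complex, makes the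
  latter invariant. Modulo all of these every \<open>(0, 0, c)\<close> is sent to
  \<open>(E c, - E c, F E c)\<close>, hence to 0.
\<close>
lemma mset_spectrum_ud_block:
  fixes U :: "complex mat"
  assumes U: "U \<in> carrier_mat n n" and E: "E \<in> carrier_mat n k" and F: "F \<in> carrier_mat k n"
    and FU: "F * U = 0\<^sub>m k n"
  shows "mset_spectrum (four_block_mat (U + 1\<^sub>m n)
            (four_block_mat (- 1\<^sub>m n) E (0\<^sub>m 0 n) (0\<^sub>m 0 k))
            (four_block_mat (- 1\<^sub>m n) (0\<^sub>m n 0) F (0\<^sub>m k 0))
            (four_block_mat (U + 1\<^sub>m n) (- E) (- F) (F * E)))
       = mset_spectrum U + image_mset (\<lambda>x. x + 2) (mset_spectrum (U + E * F)) + replicate_mset k 0"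
    (is "mset_spectrum ?M = _")
proof -
  (* Modulo the vectors (v, v, 0), the vector (v, - v, F v) equals (0, - 2 v, F v): a point of the
     graph of - F / 2. *)
  let ?X = "(- 1 / 2) \<cdot>\<^sub>m F"
  let ?A = "U + 2 \<cdot>\<^sub>m 1\<^sub>m n"
  have EF: "E * F \<in> carrier_mat n n" and FE: "F * E \<in> carrier_mat k k"
    and X: "?X \<in> carrier_mat k n" and A: "?A \<in> carrier_mat n n" and B: "- E - E \<in> carrier_mat n k"
    and FEF: "F * (E * F) \<in> carrier_mat k n"
    using U E F by auto
  have "(- E - E) * ?X = (- 1 / 2) \<cdot>\<^sub>m ((- E) * F - E * F)"
    by (subst mult_smult_distrib[OF B F], subst minus_mult_distrib_mat[of _ n k]) (use E F in auto)
  also have "\<dots> = E * F"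
    using half_mat[OF EF] E F by simp
  finally have BX: "(- E - E) * ?X = E * F" .
  have XB: "?X * (- E - E) = F * E"
  proof -
    have "?X * (- E - E) = (- 1 / 2) \<cdot>\<^sub>m (F * (- E) - F * E)"
      by (subst mult_smult_assoc_mat[OF F B], subst mult_minus_distrib_mat[of _ k n]) (use E F in auto)
    also have "\<dots> = F * E"
      using half_mat[OF FE] E F by simp
    finally show ?thesis .
  qed
  have AEF: "?A + E * F = U + E * F + 2 \<cdot>\<^sub>m 1\<^sub>m n"
    by (rule add_right_commute_mat) (use U EF in auto)
  have "F * (?A + E * F) = F * U + F * (2 \<cdot>\<^sub>m 1\<^sub>m n) + F * (E * F)"
    unfolding mult_add_distrib_mat[OF F A EF]
    using mult_add_distrib_mat[OF F U, of "2 \<cdot>\<^sub>m 1\<^sub>m n"] by simp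
  also have "\<dots> = 2 \<cdot>\<^sub>m F + F * (E * F)"
    using F FU FEF by (simp add: mult_smult_distrib[of F k n _ n])
  finally have FA: "F * (?A + E * F) = 2 \<cdot>\<^sub>m F + F * (E * F)" .
  have "- F + F * E * ?X = - F + (- 1 / 2) \<cdot>\<^sub>m (F * (E * F))"
    by (simp add: mult_smult_distrib[OF FE F] assoc_mult_mat[OF F E F])
  also have "\<dots> = (- 1 / 2) \<cdot>\<^sub>m (2 \<cdot>\<^sub>m F + F * (E * F))"
    by (rule eq_matI) (use F FEF in \<open>auto simp: algebra_simps\<close>)
  also have "\<dots> = ?X * (?A + E * F)"
    unfolding FA[symmetric] using mult_smult_assoc_mat[OF F add_carrier_mat[OF EF, of ?A]] by simp
  finally have inv: "- F + F * E * ?X = ?X * (?A + (- E - E) * ?X)" unfolding BX .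
  have "char_poly ?M = char_poly (U + 1\<^sub>m n + - 1\<^sub>m n)
      * char_poly (four_block_mat (U + 1\<^sub>m n - - 1\<^sub>m n) (- E - E) (- F) (F * E))"
    by (rule char_poly_swap_symmetric) (use U E F FE in auto)
  also have "U + 1\<^sub>m n + - 1\<^sub>m n = U"
    by (rule eq_matI) (use U in auto)
  also have "U + 1\<^sub>m n - - 1\<^sub>m n = ?A"
    by (rule eq_matI) (use U in auto)
  also have "char_poly (four_block_mat ?A (- E - E) (- F) (F * E))
      = char_poly (?A + E * F) * char_poly (F * E - F * E)"
    using char_poly_invariant_graph[OF A B _ FE X inv] F unfolding BX XB by simp
  also have "F * E - F * E = 0\<^sub>m k k"
    using FE by simp
  finally have "mset_spectrum ?M
      = mset_spectrum U + mset_spectrum (U + E * F + 2 \<cdot>\<^sub>m 1\<^sub>m n) + mset_spectrum (0\<^sub>m k k)"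
    unfolding AEF by (intro mset_spectrum_mult_char_poly) (use U EF in \<open>auto simp: mult.assoc\<close>)
  then show ?thesis
    using mset_spectrum_add_scalar[of "U + E * F" n 2] U EF by (simp add: mset_spectrum_zero_mat)
qed

text \<open>
  The dual situation, with \<open>V\<close> the down-up Laplacian one dimension lower: the vectors \<open>(v, v, 0)\<close>
  carry \<open>E F\<close> and the vectors \<open>(E c, - E c, - 2 c)\<close> carry \<open>V + F E + 2\<close>, invariance of the latter
  resting on \<open>E V = 0\<close>. Modulo all of these, \<open>(v, - v, 0)\<close> is sent to \<open>(E c, - E c, - 2 c)\<close> with
  \<open>c = F v\<close>, hence to 0.
\<close>
lemma mset_spectrum_du_block:
  fixes V :: "complex mat"
  assumes V: "V \<in> carrier_mat k k" and E: "E \<in> carrier_mat n k" and F: "F \<in> carrier_mat k n"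
    and EV: "E * V = 0\<^sub>m n k"
  shows "mset_spectrum (four_block_mat (E * F)
            (four_block_mat (0\<^sub>m n n) (- E) (0\<^sub>m 0 n) (0\<^sub>m 0 k))
            (four_block_mat (0\<^sub>m n n) (0\<^sub>m n 0) (- F) (0\<^sub>m k 0))
            (four_block_mat (E * F) E F (V + 2 \<cdot>\<^sub>m 1\<^sub>m k)))
       = mset_spectrum (E * F) + image_mset (\<lambda>x. x + 2) (mset_spectrum (V + F * E)) + replicate_mset n 0"
    (is "mset_spectrum ?M = _")
proof -
  let ?A = "V + 2 \<cdot>\<^sub>m 1\<^sub>m k"
  have EF: "E * F \<in> carrier_mat n n" and FE: "F * E \<in> carrier_mat k k"
    and A: "?A \<in> carrier_mat k k" and E2: "E + E \<in> carrier_mat n k"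
    and EFE: "E * (F * E) \<in> carrier_mat n k"
    using V E F by auto
  have AFE: "?A + F * E = V + F * E + 2 \<cdot>\<^sub>m 1\<^sub>m k"
    by (rule add_right_commute_mat) (use V FE in auto)
  have "E * (?A + F * E) = E * V + E * (2 \<cdot>\<^sub>m 1\<^sub>m k) + E * (F * E)"
    unfolding mult_add_distrib_mat[OF E A FE]
    using mult_add_distrib_mat[OF E V, of "2 \<cdot>\<^sub>m 1\<^sub>m k"] by simp
  also have "\<dots> = 2 \<cdot>\<^sub>m E + E * (F * E)"
    using E EV EFE by (simp add: mult_smult_distrib[of E n k _ k])
  also have "\<dots> = E + E + E * F * E"
    unfolding assoc_mult_mat[OF E F E] by (rule eq_matI) (use E EFE in auto)
  finally have inv: "E + E + E * F * E = E * (?A + F * E)" ..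
  have "char_poly ?M = char_poly (E * F + 0\<^sub>m n n)
      * char_poly (four_block_mat (E * F - 0\<^sub>m n n) (- (- E) - (- E)) (- (- F)) ?A)"
    using char_poly_swap_symmetric[of "E * F" n "0\<^sub>m n n" "- E" k "- F" ?A] E F EF A by simp
  also have "E * F + 0\<^sub>m n n = E * F"
    using EF by simp
  also have "E * F - 0\<^sub>m n n = E * F"
    by (rule minus_zero_mat[OF EF])
  also have "- (- E) - (- E) = E + E"
    by (rule eq_matI) (use E in auto)
  (* Modulo the vectors (v, v, 0), the vector (E c, - E c, - 2 c) equals (0, - 2 E c, - 2 c): a point
     of the graph of E over the last component, which is therefore put first. *)
  also have "char_poly (four_block_mat (E * F) (E + E) (- (- F)) ?A)
      = char_poly (four_block_mat ?A F (E + E) (E * F))"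
    using char_poly_four_block_swap[OF EF E2 F A] by simp
  also have "\<dots> = char_poly (?A + F * E) * char_poly (E * F - E * F)"
    by (rule char_poly_invariant_graph[OF A F E2 EF E inv])
  also have "E * F - E * F = 0\<^sub>m n n"
    using EF by simp
  finally have "mset_spectrum ?M
      = mset_spectrum (E * F) + mset_spectrum (V + F * E + 2 \<cdot>\<^sub>m 1\<^sub>m k) + mset_spectrum (0\<^sub>m n n)"
    unfolding AFE by (intro mset_spectrum_mult_char_poly) (use V FE EF in \<open>auto simp: mult.assoc\<close>)
  then show ?thesis
    using mset_spectrum_add_scalar[of "V + F * E" k 2] V FE by (simp add: mset_spectrum_zero_mat)
qed

lemma mset_spectrum_tot_block:
  fixes L :: "complex mat"
  assumes L: "L \<in> carrier_mat n n" and L': "L' \<in> carrier_mat k k"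
  shows "mset_spectrum (four_block_mat (L + 1\<^sub>m n)
            (four_block_mat (- 1\<^sub>m n) (0\<^sub>m n k) (0\<^sub>m 0 n) (0\<^sub>m 0 k))
            (four_block_mat (- 1\<^sub>m n) (0\<^sub>m n 0) (0\<^sub>m k n) (0\<^sub>m k 0))
            (four_block_mat (L + 1\<^sub>m n) (0\<^sub>m n k) (0\<^sub>m k n) (L' + 2 \<cdot>\<^sub>m 1\<^sub>m k)))
       = mset_spectrum L + image_mset (\<lambda>x. x + 2) (mset_spectrum L) + image_mset (\<lambda>x. x + 2) (mset_spectrum L')"
    (is "mset_spectrum ?M = _")
proof -
  let ?A = "L + 2 \<cdot>\<^sub>m 1\<^sub>m n"
  let ?A' = "L' + 2 \<cdot>\<^sub>m 1\<^sub>m k"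
  have "char_poly ?M = char_poly (L + 1\<^sub>m n + - 1\<^sub>m n)
      * char_poly (four_block_mat (L + 1\<^sub>m n - - 1\<^sub>m n) (- 0\<^sub>m n k - 0\<^sub>m n k) (- 0\<^sub>m k n) ?A')"
    using char_poly_swap_symmetric[of "L + 1\<^sub>m n" n "- 1\<^sub>m n" "0\<^sub>m n k" k "0\<^sub>m k n" ?A'] L L'
    by simp
  also have "L + 1\<^sub>m n + - 1\<^sub>m n = L"
    by (rule eq_matI) (use L in auto)
  also have "L + 1\<^sub>m n - - 1\<^sub>m n = ?A"
    by (rule eq_matI) (use L in auto)
  also have "char_poly (four_block_mat ?A (- 0\<^sub>m n k - 0\<^sub>m n k) (- 0\<^sub>m k n) ?A')
      = char_poly ?A * char_poly ?A'"
    using char_poly_four_block_lower_left_zero[of ?A n "0\<^sub>m n k - 0\<^sub>m n k" k ?A'] L L'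
    by (simp add: minus_carrier_mat)
  finally have "mset_spectrum ?M = mset_spectrum L + mset_spectrum ?A + mset_spectrum ?A'"
    by (intro mset_spectrum_mult_char_poly) (use L L' in \<open>auto simp: mult.assoc\<close>)
  then show ?thesis
    using L L' by (simp add: mset_spectrum_add_scalar)
qed

section \<open>Incidence numbers and the last coordinate\<close>

lemma mult_if_zero:
  "(if P then a else 0) * b = (if P then a * b else (0 :: 'a :: mult_zero))"
  "b * (if P then a else 0) = (if P then b * a else (0 :: 'a :: mult_zero))"
  by simp_all

lemma finite_dir [simp]: "finite (dir f)"
  by (simp add: dir_def)

lemma dir_snoc: "dir (f @ [x]) = (if x = Star then insert (length f) (dir f) else dir f)"
  by (auto simp: dir_def nth_append less_Suc_eq)

lemma face_dim_snoc: "face_dim (f @ [x]) = (if x = Star then Suc (face_dim f) else face_dim f)"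
  by (simp add: face_dim_def dir_snoc) (simp add: dir_def)

lemma face_le_snoc:
  assumes "length f = length g"
  shows "face_le (f @ [x]) (g @ [y]) \<longleftrightarrow> face_le f g \<and> coord_le x y"
  using assms by (simp add: face_le_def list_all2_append)

lemma face_le_dir: "face_le f g \<Longrightarrow> dir f \<subseteq> dir g"
  by (auto simp: face_le_def dir_def list_all2_conv_all_nth coord_le_def)

lemma face_le_same_dim:
  assumes le: "face_le f g" and "face_dim f = face_dim g"
  shows "f = g"
proof (rule nth_equalityI)
  show len: "length f = length g"
    using le by (simp add: face_le_def list_all2_lengthD)
  have "dir f = dir g"
    using assms face_le_dir[OF le] by (simp add: card_subset_eq face_dim_def)
  then show "f ! k = g ! k" if "k < length f" for k
  proof -
    have "coord_le (f ! k) (g ! k)" "f ! k = Star \<longleftrightarrow> g ! k = Star"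
      using le \<open>dir f = dir g\<close> that len
      by (auto simp: face_le_def list_all2_conv_all_nth dir_def set_eq_iff)
    then show ?thesis
      by (auto simp: coord_le_def)
  qed
qed

lemma incidence_nonzero_face_le:
  "incidence f g \<noteq> 0 \<Longrightarrow> face_le f g \<and> face_dim g = Suc (face_dim f)"
  by (auto simp: incidence_def split: if_splits)

lemma facet_direction:
  assumes "face_le f g" "face_dim g = Suc (face_dim f)"
  obtains a where "a \<in> dir g" "dir f = dir g - {a}"
proof -
  have "card (dir g - dir f) = 1"
    using assms face_le_dir[of f g] by (simp add: card_Diff_subset face_dim_def)
  then obtain a where "dir g - dir f = {a}"
    by (auto simp: card_1_singleton_iff)
  then show thesis
    using face_le_dir[OF assms(1)] by (intro that[of a]) auto
qed

text \<open>
  Any direction that distinguishes the two faces is the one selected by the definite description in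
  the definition of the incidence numbers.
\<close>
lemma incidence_facet:
  assumes "face_le f g" and a: "a \<in> dir g" "dir f = dir g - {a}"
  shows "incidence f g =
    (if f ! a = Zero then (- 1) ^ card {b \<in> dir g. b \<le> a} else (- 1) ^ (card {b \<in> dir g. b \<le> a} + 1))"
proof -
  have "face_dim g = Suc (face_dim f)"
    using a card_Suc_Diff1[of "dir g" a] by (simp add: face_dim_def)
  moreover have "(THE a. a \<in> dir g \<and> dir f = dir g - {a}) = a"
    using a by (intro the_equality) auto
  ultimately show ?thesis
    using assms by (simp add: incidence_def Let_def)
qed

text \<open>
  A last coordinate comes after all others, so it does not change the rank of the direction that is
  lost.
\<close>
lemma incidence_snoc_same:
  assumes len: "length f = length g"
  shows "incidence (f @ [x]) (g @ [x]) = incidence f g"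
proof (cases "face_le f g \<and> face_dim g = Suc (face_dim f)")
  case True
  then obtain a where a: "a \<in> dir g" "dir f = dir g - {a}"
    using facet_direction by blast
  have a_less: "a < length f"
    using a len by (simp add: dir_def)
  have "incidence (f @ [x]) (g @ [x]) =
    (if (f @ [x]) ! a = Zero then (- 1) ^ card {b \<in> dir (g @ [x]). b \<le> a}
     else (- 1) ^ (card {b \<in> dir (g @ [x]). b \<le> a} + 1))"
    using True a a_less len
    by (intro incidence_facet) (auto simp: face_le_snoc coord_le_def dir_snoc)
  moreover have "{b \<in> dir (g @ [x]). b \<le> a} = {b \<in> dir g. b \<le> a}"
    using a_less len by (auto simp: dir_snoc)
  ultimately show ?thesis
    using True a a_less incidence_facet[of f g a] by (simp add: nth_append)
next
  case False
  then have "\<not> (face_le (f @ [x]) (g @ [x]) \<and> face_dim (g @ [x]) = Suc (face_dim (f @ [x])))"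
    using len by (auto simp: face_le_snoc face_dim_snoc)
  then show ?thesis
    using False incidence_nonzero_face_le by metis
qed

text \<open>
  The direction that is lost is the last one, hence of rank \<open>face_dim g + 1\<close>.
\<close>
lemma incidence_snoc_Star:
  assumes len: "length f = length g" and x: "x \<noteq> Star"
  shows "incidence (f @ [x]) (g @ [Star]) =
    (if f = g then if x = Zero then - ((- 1) ^ face_dim g) else (- 1) ^ face_dim g else 0)"
proof (cases "f = g")
  case True
  have "face_le g g" "length g \<notin> dir g"
    by (simp_all add: face_le_def coord_le_def list_all2_refl dir_def)
  then have "incidence (f @ [x]) (g @ [Star]) =
    (if (f @ [x]) ! length g = Zero then (- 1) ^ card {b \<in> dir (g @ [Star]). b \<le> length g}
     else (- 1) ^ (card {b \<in> dir (g @ [Star]). b \<le> length g} + 1))"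
    using True x by (intro incidence_facet) (auto simp: face_le_snoc coord_le_def dir_snoc)
  moreover have "{b \<in> dir (g @ [Star]). b \<le> length g} = dir (g @ [Star])"
    by (auto simp: dir_def)
  ultimately show ?thesis
    using True face_dim_snoc[of g Star] by (simp add: face_dim_def)
next
  case False
  then have "\<not> (face_le (f @ [x]) (g @ [Star]) \<and> face_dim (g @ [Star]) = Suc (face_dim (f @ [x])))"
    using len x face_le_same_dim by (auto simp: face_le_snoc face_dim_snoc)
  then show ?thesis
    using False incidence_nonzero_face_le by metis
qed

lemma incidence_snoc_other:
  assumes "length f = length g" "x \<noteq> y" "y \<noteq> Star"
  shows "incidence (f @ [x]) (g @ [y]) = 0"
  using assms incidence_nonzero_face_le[of "f @ [x]" "g @ [y]"]
  by (auto simp: face_le_snoc coord_le_def)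

lemmas incidence_snoc = incidence_snoc_same incidence_snoc_Star incidence_snoc_other

lemma UNIV_coord: "(UNIV :: coord set) = {Zero, One, Star}"
  using coord.exhaust by blast

lemma finite_cube [simp]: "finite (cube n)"
proof -
  have "finite (UNIV :: coord set)"
    by (simp add: UNIV_coord)
  then show ?thesis
    using finite_lists_length_eq[of "UNIV :: coord set" n] by (simp add: cube_def)
qed

lemma cube_Suc: "cube (Suc n) = (\<lambda>(g, y). g @ [y]) ` (cube n \<times> {Zero, One, Star})"
proof
  show "cube (Suc n) \<subseteq> (\<lambda>(g, y). g @ [y]) ` (cube n \<times> {Zero, One, Star})"
  proof
    fix f assume "f \<in> cube (Suc n)"
    then obtain g y where "f = g @ [y]" "g \<in> cube n"
      by (cases f rule: rev_exhaust) (auto simp: cube_def)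
    then show "f \<in> (\<lambda>(g, y). g @ [y]) ` (cube n \<times> {Zero, One, Star})"
      using UNIV_coord by (auto intro!: image_eqI[of _ _ "(g, y)"])
  qed
qed (auto simp: cube_def)

lemma sum_cube_Suc:
  "(\<Sum>g\<in>cube (Suc n). \<phi> g) =
   (\<Sum>g\<in>cube n. \<phi> (g @ [Zero]) + (\<phi> (g @ [One]) + \<phi> (g @ [Star])))"
proof -
  have "(\<Sum>g\<in>cube (Suc n). \<phi> g) = (\<Sum>(g, y)\<in>cube n \<times> {Zero, One, Star}. \<phi> (g @ [y]))"
    unfolding cube_Suc by (subst sum.reindex) (auto simp: inj_on_def case_prod_unfold)
  also have "\<dots> = (\<Sum>g\<in>cube n. \<Sum>y\<in>{Zero, One, Star}. \<phi> (g @ [y]))"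
    by (rule sum.cartesian_product[symmetric])
  finally show ?thesis by simp
qed

text \<open>
  The boundary of a boundary vanishes. Splitting off the last coordinate, the only new case is that
  of a face of the bottom or top below a face in the last direction: the last coordinate can be
  fixed before or after passing from \<open>h\<close> to \<open>f\<close>, and the two signs differ because the dimensions
  of \<open>f\<close> and \<open>h\<close> do.
\<close>
lemma incidence_square_zero:
  "f \<in> cube n \<Longrightarrow> h \<in> cube n \<Longrightarrow> (\<Sum>g\<in>cube n. incidence f g * incidence g h) = 0"
proof (induction n arbitrary: f h)
  case 0
  then show ?case by (simp add: cube_def incidence_def)
next
  case (Suc n)
  obtain f' x where f: "f = f' @ [x]" "f' \<in> cube n"
    using Suc.prems(1) by (auto simp: cube_Suc)
  obtain h' z where h: "h = h' @ [z]" "h' \<in> cube n"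
    using Suc.prems(2) by (auto simp: cube_Suc)
  note IH = Suc.IH[OF f(2) h(2)]
  (* The two paths from a face in the last direction down to the bottom or top cancel. *)
  have anti: "incidence f' h' * (- 1) ^ face_dim h' + (- 1) ^ face_dim f' * incidence f' h' = 0"
    using incidence_nonzero_face_le[of f' h'] by (cases "incidence f' h' = 0") auto
  have len: "\<And>g. g \<in> cube n \<Longrightarrow> length g = n"
    by (simp add: cube_def)
  have mem: "f' \<in> cube n" "h' \<in> cube n" by fact+
  show ?case
    unfolding sum_cube_Suc f h
    using IH anti
    by (cases x; cases z)
      (simp_all add: incidence_snoc len mem sum.distrib mult_if_zero algebra_simps)
qed

section \<open>Matrices indexed by lists\<close>

text \<open>
  Rows and columns are labelled by the entries of lists. For lists without repetition products become
  sums over sets, so that only the underlying sets matter for the spectrum.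
\<close>
definition kernel_mat :: "'a list \<Rightarrow> 'b list \<Rightarrow> ('a \<Rightarrow> 'b \<Rightarrow> 'c) \<Rightarrow> 'c mat" where
  "kernel_mat xs ys K = mat (length xs) (length ys) (\<lambda>(p, q). K (xs ! p) (ys ! q))"

lemma kernel_mat_carrier [simp]: "kernel_mat xs ys K \<in> carrier_mat (length xs) (length ys)"
  by (simp add: kernel_mat_def)

lemma dim_kernel_mat [simp]:
  "dim_row (kernel_mat xs ys K) = length xs" "dim_col (kernel_mat xs ys K) = length ys"
  by (simp_all add: kernel_mat_def)

lemma index_kernel_mat [simp]:
  "p < length xs \<Longrightarrow> q < length ys \<Longrightarrow> kernel_mat xs ys K $$ (p, q) = K (xs ! p) (ys ! q)"
  by (simp add: kernel_mat_def)

lemma kernel_mat_cong: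
  assumes "\<And>x y. x \<in> set xs \<Longrightarrow> y \<in> set ys \<Longrightarrow> K x y = M x y"
  shows "kernel_mat xs ys K = kernel_mat xs ys M"
  by (rule eq_matI) (use assms in auto)

lemma kernel_mat_mult:
  assumes "distinct ys"
  shows "kernel_mat xs ys K * kernel_mat ys zs M
    = kernel_mat xs zs (\<lambda>x z. \<Sum>y\<in>set ys. K x y * M y z)"
proof (rule eq_matI)
  fix p q assume "p < dim_row (kernel_mat xs zs (\<lambda>x z. \<Sum>y\<in>set ys. K x y * M y z))"
    "q < dim_col (kernel_mat xs zs (\<lambda>x z. \<Sum>y\<in>set ys. K x y * M y z))"
  then have pq: "p < length xs" "q < length zs" by simp_all
  have "(kernel_mat xs ys K * kernel_mat ys zs M) $$ (p, q)
      = (\<Sum>i<length ys. K (xs ! p) (ys ! i) * M (ys ! i) (zs ! q))"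
    using pq by (simp add: scalar_prod_def lessThan_atLeast0)
  also have "\<dots> = (\<Sum>y\<in>set ys. K (xs ! p) y * M y (zs ! q))"
    using sum.reindex_bij_betw[OF bij_betw_nth[OF assms refl refl]] by simp
  finally show "(kernel_mat xs ys K * kernel_mat ys zs M) $$ (p, q)
      = kernel_mat xs zs (\<lambda>x z. \<Sum>y\<in>set ys. K x y * M y z) $$ (p, q)"
    using pq by simp
qed simp_all

lemma transpose_kernel_mat: "transpose_mat (kernel_mat xs ys K) = kernel_mat ys xs (\<lambda>y x. K x y)"
  by (rule eq_matI) auto

lemma kernel_mat_add:
  "kernel_mat xs ys K + kernel_mat xs ys M = kernel_mat xs ys (\<lambda>x y. K x y + M x y)"
  by (rule eq_matI) auto

lemma kernel_mat_uminus: "- kernel_mat xs ys K = kernel_mat xs ys (\<lambda>x y. - K x y)"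
  by (rule eq_matI) auto

lemma kernel_mat_zero: "0\<^sub>m (length xs) (length ys) = kernel_mat xs ys (\<lambda>x y. 0)"
  by (rule eq_matI) auto

lemma kernel_mat_scalar:
  assumes "distinct xs"
  shows "c \<cdot>\<^sub>m 1\<^sub>m (length xs)
    = kernel_mat xs xs (\<lambda>x y. if x = y then c else (0 :: 'a :: semiring_1))"
  by (rule eq_matI) (use assms in \<open>auto simp: nth_eq_iff_index_eq\<close>)

lemma kernel_mat_one:
  assumes "distinct xs"
  shows "1\<^sub>m (length xs) = kernel_mat xs xs (\<lambda>x y. if x = y then 1 else 0)"
  by (rule eq_matI) (use assms in \<open>auto simp: nth_eq_iff_index_eq\<close>)

lemma kernel_mat_append:
  "kernel_mat (xs @ xs') (ys @ ys') K = four_block_mat (kernel_mat xs ys K) (kernel_mat xs ys' K)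
     (kernel_mat xs' ys K) (kernel_mat xs' ys' K)"
  by (rule eq_matI) (auto simp: nth_append)

lemma kernel_mat_map:
  "kernel_mat (map h xs) (map k ys) K = kernel_mat xs ys (\<lambda>x y. K (h x) (k y))"
  by (rule eq_matI) auto

lemma kernel_mat_Nil:
  "kernel_mat [] ys K = 0\<^sub>m 0 (length ys)" "kernel_mat xs [] K = 0\<^sub>m (length xs) 0"
  by (rule eq_matI; simp)+

lemma kernel_mat_append_right:
  "kernel_mat xs (ys @ ys') K =
     four_block_mat (kernel_mat xs ys K) (kernel_mat xs ys' K) (0\<^sub>m 0 (length ys)) (0\<^sub>m 0 (length ys'))"
  using kernel_mat_append[of xs "[]" ys ys' K] by (simp add: kernel_mat_Nil)

lemma kernel_mat_append_left:
  "kernel_mat (xs @ xs') ys K =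
     four_block_mat (kernel_mat xs ys K) (0\<^sub>m (length xs) 0) (kernel_mat xs' ys K) (0\<^sub>m (length xs') 0)"
  using kernel_mat_append[of xs xs' ys "[]" K] by (simp add: kernel_mat_Nil)

text \<open>
  The matrices that compare the two orders of the basis are mutually inverse permutation matrices.
\<close>
lemma char_poly_kernel_mat_reorder:
  fixes K :: "'a \<Rightarrow> 'a \<Rightarrow> 'c :: comm_ring_1"
  assumes xs: "distinct xs" and ys: "distinct ys" and set: "set xs = set ys"
  shows "char_poly (kernel_mat xs xs K) = char_poly (kernel_mat ys ys K)"
proof -
  let ?P = "kernel_mat xs ys (\<lambda>x y. if x = y then 1 else 0 :: 'c)"
  let ?Q = "kernel_mat ys xs (\<lambda>x y. if x = y then 1 else 0 :: 'c)"
  have len: "length xs = length ys"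
    using distinct_card[OF xs] distinct_card[OF ys] set by simp
  have PQ: "?P * ?Q = 1\<^sub>m (length xs)"
    unfolding kernel_mat_mult[OF ys] kernel_mat_one[OF xs]
    by (rule kernel_mat_cong) (simp add: set mult_if_zero)
  have QP: "?Q * ?P = 1\<^sub>m (length xs)"
    unfolding kernel_mat_mult[OF xs] len kernel_mat_one[OF ys]
    by (rule kernel_mat_cong) (simp add: set mult_if_zero)
  have PKQ: "?P * kernel_mat ys ys K * ?Q = kernel_mat xs xs K"
    unfolding kernel_mat_mult[OF ys]
    by (rule kernel_mat_cong) (simp add: set mult_if_zero)
  have "{kernel_mat xs xs K, kernel_mat ys ys K, ?P, ?Q} \<subseteq> carrier_mat (length xs) (length xs)"
    by (intro insert_subsetI empty_subsetI carrier_matI) (simp_all add: len)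
  then have "similar_mat (kernel_mat xs xs K) (kernel_mat ys ys K)"
    by (rule similar_matI[OF _ PQ QP PKQ[symmetric]])
  then show ?thesis
    by (rule char_poly_similar)
qed

section \<open>Entries of the Laplacians\<close>

abbreviation inc :: "face \<Rightarrow> face \<Rightarrow> complex" where
  "inc f g \<equiv> of_int (incidence f g)"

definition ud :: "nat \<Rightarrow> face set \<Rightarrow> int \<Rightarrow> face \<Rightarrow> face \<Rightarrow> complex" where
  "ud n X i f g = (\<Sum>h\<in>set (faces n X (i + 1)). inc f h * inc g h)"

definition du :: "nat \<Rightarrow> face set \<Rightarrow> int \<Rightarrow> face \<Rightarrow> face \<Rightarrow> complex" where
  "du n X i f g = (\<Sum>h\<in>set (faces n X (i - 1)). inc h f * inc h g)"

lemma set_faces: "set (faces n X i) = {f \<in> cube n. f \<in> X \<and> int (face_dim f) = i}"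
  using UNIV_coord by (auto simp: faces_def set_n_lists cube_def)

lemma distinct_faces [simp]: "distinct (faces n X i)"
  by (simp add: faces_def distinct_n_lists)

lemma boundary_kernel_mat:
  "map_mat of_int (boundary n X i) = kernel_mat (faces n X (i - 1)) (faces n X i) inc"
  by (rule eq_matI) (auto simp: boundary_def)

lemma boundary_carrier:
  "boundary n X i \<in> carrier_mat (length (faces n X (i - 1))) (length (faces n X i))"
  by (simp add: boundary_def)

lemma L_ud_kernel_mat:
  "map_mat of_int (L_ud n X i) = kernel_mat (faces n X i) (faces n X i) (ud n X i)"
proof -
  have "map_mat of_int (L_ud n X i) = (map_mat of_int (boundary n X (i + 1))
      * transpose_mat (map_mat of_int (boundary n X (i + 1))) :: complex mat)"
    unfolding L_ud_def map_mat_transpose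
    by (rule of_int_hom.mat_hom_mult[OF boundary_carrier]) (use boundary_carrier[of n X "i + 1"] in simp)
  then show ?thesis
    unfolding boundary_kernel_mat transpose_kernel_mat kernel_mat_mult[OF distinct_faces] ud_def[abs_def]
    by simp
qed

lemma L_du_kernel_mat:
  "map_mat of_int (L_du n X i) = kernel_mat (faces n X i) (faces n X i) (du n X i)"
proof -
  have "map_mat of_int (L_du n X i) = (transpose_mat (map_mat of_int (boundary n X i))
      * map_mat of_int (boundary n X i) :: complex mat)"
    unfolding L_du_def map_mat_transpose
    by (rule of_int_hom.mat_hom_mult[OF _ boundary_carrier]) (use boundary_carrier[of n X i] in simp)
  then show ?thesis
    unfolding boundary_kernel_mat transpose_kernel_mat kernel_mat_mult[OF distinct_faces] du_def[abs_def]
    by simp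
qed

lemma L_tot_kernel_mat:
  "map_mat of_int (L_tot n X i)
     = kernel_mat (faces n X i) (faces n X i) (\<lambda>f g. ud n X i f g + du n X i f g)"
proof -
  have "map_mat of_int (L_tot n X i) = (map_mat of_int (L_ud n X i) + map_mat of_int (L_du n X i) :: complex mat)"
    by (rule eq_matI) (auto simp: L_tot_def L_ud_def L_du_def boundary_def)
  then show ?thesis
    unfolding L_ud_kernel_mat L_du_kernel_mat kernel_mat_add .
qed

section \<open>The faces of the prism\<close>

text \<open>
  In this order of the basis, with bottom, top and vertical faces grouped together, the Laplacians of
  the prism become block matrices.
\<close>
definition prism_faces :: "nat \<Rightarrow> face set \<Rightarrow> int \<Rightarrow> face list" where
  "prism_faces n X i = map (\<lambda>f. f @ [Zero]) (faces n X i) @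
     (map (\<lambda>f. f @ [One]) (faces n X i) @ map (\<lambda>f. f @ [Star]) (faces n X (i - 1)))"

lemma distinct_prism_faces: "distinct (prism_faces n X i)"
  by (auto simp: prism_faces_def distinct_map inj_on_def)

lemma set_prism_faces: "set (prism_faces n X i) = set (faces (Suc n) (prism n X) i)"
proof -
  have len: "f \<in> cube n \<Longrightarrow> take n (f @ [x]) = f" for f x
    by (simp add: cube_def)
  have "f @ [x] \<in> set (faces (Suc n) (prism n X) i) \<longleftrightarrow> f @ [x] \<in> set (prism_faces n X i)"
    if "f \<in> cube n" for f x
    using that by (cases x) (auto simp: prism_faces_def set_faces prism_def face_dim_snoc len cube_def)
  moreover have "\<exists>f\<in>cube n. \<exists>x. g = f @ [x]" if "g \<in> set (faces (Suc n) (prism n X) i)" for g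
    using that by (auto simp: set_faces cube_Suc)
  moreover have "\<exists>f\<in>cube n. \<exists>x. g = f @ [x]" if "g \<in> set (prism_faces n X i)" for g
    using that by (auto simp: prism_faces_def set_faces)
  ultimately show ?thesis by blast
qed

lemma sum_prism_faces:
  "(\<Sum>H\<in>set (faces (Suc n) (prism n X) i). \<phi> H)
    = (\<Sum>h\<in>set (faces n X i). \<phi> (h @ [Zero]))
    + ((\<Sum>h\<in>set (faces n X i). \<phi> (h @ [One])) + (\<Sum>h\<in>set (faces n X (i - 1)). \<phi> (h @ [Star])))"
proof -
  have "(\<Sum>H\<in>set (faces (Suc n) (prism n X) i). \<phi> H) = sum_list (map \<phi> (prism_faces n X i))"
    unfolding set_prism_faces[symmetric] by (rule sum_list_distinct_conv_sum_set[symmetric, OF distinct_prism_faces])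
  also have "\<dots> = sum_list (map (\<lambda>h. \<phi> (h @ [Zero])) (faces n X i))
      + (sum_list (map (\<lambda>h. \<phi> (h @ [One])) (faces n X i))
      + sum_list (map (\<lambda>h. \<phi> (h @ [Star])) (faces n X (i - 1))))"
    by (simp add: prism_faces_def o_def)
  finally show ?thesis
    by (simp only: sum_list_distinct_conv_sum_set distinct_faces)
qed

lemma mset_spectrum_prism_kernel_mat:
  fixes n X i and K :: "face \<Rightarrow> face \<Rightarrow> complex"
  defines "A \<equiv> faces n X i" and "C \<equiv> faces n X (i - 1)"
  shows "mset_spectrum (kernel_mat (faces (Suc n) (prism n X) i) (faces (Suc n) (prism n X) i) K)
    = mset_spectrum (four_block_mat (kernel_mat A A (\<lambda>f g. K (f @ [Zero]) (g @ [Zero])))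
        (four_block_mat (kernel_mat A A (\<lambda>f g. K (f @ [Zero]) (g @ [One])))
           (kernel_mat A C (\<lambda>f c. K (f @ [Zero]) (c @ [Star])))
           (0\<^sub>m 0 (length A)) (0\<^sub>m 0 (length C)))
        (four_block_mat (kernel_mat A A (\<lambda>f g. K (f @ [One]) (g @ [Zero]))) (0\<^sub>m (length A) 0)
           (kernel_mat C A (\<lambda>c f. K (c @ [Star]) (f @ [Zero]))) (0\<^sub>m (length C) 0))
        (four_block_mat (kernel_mat A A (\<lambda>f g. K (f @ [One]) (g @ [One])))
           (kernel_mat A C (\<lambda>f c. K (f @ [One]) (c @ [Star])))
           (kernel_mat C A (\<lambda>c f. K (c @ [Star]) (f @ [One])))
           (kernel_mat C C (\<lambda>c c'. K (c @ [Star]) (c' @ [Star])))))"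
proof -
  let ?P = "prism_faces n X i"
  have "mset_spectrum (kernel_mat (faces (Suc n) (prism n X) i) (faces (Suc n) (prism n X) i) K)
      = mset_spectrum (kernel_mat ?P ?P K)"
    unfolding mset_spectrum_def
    by (subst char_poly_kernel_mat_reorder[OF distinct_faces distinct_prism_faces set_prism_faces[symmetric]])
      (rule refl)
  then show ?thesis
    unfolding prism_faces_def A_def C_def
    by (simp only: kernel_mat_append kernel_mat_append_left[of "map _ _"]
      kernel_mat_append_right[of "map _ _"] kernel_mat_map length_map)
qed

section \<open>The Laplacians of the prism\<close>

text \<open>
  Up to sign, the incidence of the bottom or top of a vertical face over a face of dimension \<open>i\<close>.
\<close>
definition orient :: "int \<Rightarrow> complex" where
  "orient i = (- 1) ^ nat i"

lemma orient_square [simp]: "orient i * orient i = 1" "orient i * (orient i * z) = z"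
  by (simp_all add: orient_def mult.assoc[symmetric] power_mult_distrib[symmetric])

lemma length_faces: "f \<in> set (faces n X i) \<Longrightarrow> length f = n"
  by (simp add: set_faces cube_def)

lemma orient_faces:
  assumes "f \<in> set (faces n X i)"
  shows "(- 1) ^ face_dim f = orient i"
  using assms by (auto simp: set_faces orient_def)

lemma orient_pred:
  assumes "c \<in> set (faces n X (i - 1))"
  shows "orient (i - 1) = - orient i"
proof -
  have "nat i = Suc (nat (i - 1))"
    using assms by (auto simp: set_faces)
  then show ?thesis
    by (simp add: orient_def)
qed

lemma inc_snoc:
  assumes "length f = n" "h \<in> set (faces n X i)"
  shows "inc (f @ [x]) (h @ [x]) = inc f h"
    "inc (f @ [Zero]) (h @ [Star]) = (if f = h then - orient i else 0)"
    "inc (f @ [One]) (h @ [Star]) = (if f = h then orient i else 0)"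
    "y \<noteq> Star \<Longrightarrow> x \<noteq> y \<Longrightarrow> inc (f @ [x]) (h @ [y]) = 0"
  using assms length_faces[OF assms(2)] orient_faces[OF assms(2)]
  by (simp_all add: incidence_snoc)

text \<open>
  Two bottom faces meet in the vertical face above them only if they are equal, which adds the
  identity; for a bottom and a top face this vertical face is the only contribution, with sign -1.
\<close>
lemma ud_prism:
  assumes f: "f \<in> set (faces n X i)" and g: "g \<in> set (faces n X i)"
  shows "ud (Suc n) (prism n X) i (f @ [Zero]) (g @ [Zero]) = ud n X i f g + (if f = g then 1 else 0)"
    "ud (Suc n) (prism n X) i (f @ [One]) (g @ [One]) = ud n X i f g + (if f = g then 1 else 0)"
    "ud (Suc n) (prism n X) i (f @ [Zero]) (g @ [One]) = - (if f = g then 1 else 0)"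
    "ud (Suc n) (prism n X) i (f @ [One]) (g @ [Zero]) = - (if f = g then 1 else 0)"
  using length_faces[OF f] length_faces[OF g] f g
  by (simp_all add: ud_def sum_prism_faces inc_snoc mult_if_zero)

text \<open>
  The only common upper neighbour that can contribute is the vertical face over \<open>f\<close>.
\<close>
lemma ud_prism_Star:
  assumes f: "f \<in> set (faces n X i)" and c: "c \<in> set (faces n X (i - 1))"
  shows "ud (Suc n) (prism n X) i (f @ [Zero]) (c @ [Star]) = - orient i * inc c f"
    "ud (Suc n) (prism n X) i (f @ [One]) (c @ [Star]) = - (- orient i * inc c f)"
    "ud (Suc n) (prism n X) i (c @ [Star]) (f @ [Zero]) = - orient i * inc c f"
    "ud (Suc n) (prism n X) i (c @ [Star]) (f @ [One]) = - (- orient i * inc c f)"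
  using length_faces[OF f] length_faces[OF c] f c
  by (simp_all add: ud_def sum_prism_faces inc_snoc mult_if_zero)

lemma ud_prism_Star_Star:
  assumes c: "c \<in> set (faces n X (i - 1))" and c': "c' \<in> set (faces n X (i - 1))"
  shows "ud (Suc n) (prism n X) i (c @ [Star]) (c' @ [Star]) = ud n X (i - 1) c c'"
  using length_faces[OF c] length_faces[OF c']
  by (simp add: ud_def sum_prism_faces inc_snoc)

lemma du_prism:
  assumes f: "f \<in> set (faces n X i)" and g: "g \<in> set (faces n X i)"
  shows "du (Suc n) (prism n X) i (f @ [Zero]) (g @ [Zero]) = du n X i f g"
    "du (Suc n) (prism n X) i (f @ [One]) (g @ [One]) = du n X i f g"
    "du (Suc n) (prism n X) i (f @ [Zero]) (g @ [One]) = 0"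
    "du (Suc n) (prism n X) i (f @ [One]) (g @ [Zero]) = 0"
  using f g length_faces[of _ n X]
  by (simp_all add: du_def sum_prism_faces inc_snoc)

text \<open>
  The common lower neighbour is the bottom or top of the vertical face, whose sign belongs to dimension
  \<open>i - 1\<close>. This is why the entries are the negatives of those in the up-down Laplacian, so that the
  sum has no entries between vertical and horizontal faces.
\<close>
lemma du_prism_Star:
  assumes f: "f \<in> set (faces n X i)" and c: "c \<in> set (faces n X (i - 1))"
  shows "du (Suc n) (prism n X) i (f @ [Zero]) (c @ [Star]) = - (- orient i * inc c f)"
    "du (Suc n) (prism n X) i (f @ [One]) (c @ [Star]) = - orient i * inc c f"
    "du (Suc n) (prism n X) i (c @ [Star]) (f @ [Zero]) = - (- orient i * inc c f)"
    "du (Suc n) (prism n X) i (c @ [Star]) (f @ [One]) = - orient i * inc c f"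
  using f c length_faces[of _ n X] orient_pred[OF c]
  by (simp_all add: du_def sum_prism_faces inc_snoc mult_if_zero)

text \<open>
  The summand 2 comes from the bottom and the top of a vertical face.
\<close>
lemma du_prism_Star_Star:
  assumes c: "c \<in> set (faces n X (i - 1))" and c': "c' \<in> set (faces n X (i - 1))"
  shows "du (Suc n) (prism n X) i (c @ [Star]) (c' @ [Star])
    = du n X (i - 1) c c' + (if c = c' then 2 else 0)"
  using c c' length_faces[of _ n X]
  by (simp add: du_def sum_prism_faces inc_snoc mult_if_zero)

text \<open>
  All faces between \<open>c\<close> and \<open>h\<close> lie in the complex because it is an order ideal, so the sum
  agrees with the one over the whole cube.
\<close>
lemma sum_inc_inc_zero:
  assumes X: "cubical_complex n X"
    and c: "c \<in> set (faces n X (i - 1))" and h: "h \<in> set (faces n X j)"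
  shows "(\<Sum>f\<in>set (faces n X i). inc c f * inc f h) = 0"
proof -
  have "(\<Sum>f\<in>set (faces n X i). inc c f * inc f h) = (\<Sum>f\<in>cube n. inc c f * inc f h)"
  proof (rule sum.mono_neutral_left)
    show "\<forall>f\<in>cube n - set (faces n X i). inc c f * inc f h = 0"
    proof (intro ballI, rule ccontr)
      fix f assume f: "f \<in> cube n - set (faces n X i)" and "inc c f * inc f h \<noteq> 0"
      then have "face_dim f = Suc (face_dim c)" "face_le f h"
        using incidence_nonzero_face_le[of c f] incidence_nonzero_face_le[of f h] by auto
      moreover have "f \<in> X"
        using X h f \<open>face_le f h\<close> unfolding cubical_complex_def set_faces by blast
      ultimately show False
        using f c by (simp add: set_faces)
    qed
  qed (auto simp: set_faces)
  also have "\<dots> = of_int (\<Sum>f\<in>cube n. incidence c f * incidence f h)"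
    by simp
  also have "\<dots> = 0"
    using c h by (simp only: incidence_square_zero set_faces mem_Collect_eq) simp
  finally show ?thesis .
qed

context
  fixes n :: nat and X :: "face set" and i :: int
begin

text \<open>
  The same list \<open>hor\<close> labels both the bottom and the top faces, and \<open>ver\<close> the vertical ones. The sign
  in \<open>bd\<close> and in its transpose \<open>cobd\<close> is that of the incidence between the bottom and a vertical face
  over a face of dimension \<open>i\<close>; it disappears in their products.
\<close>
abbreviation (input) "hor \<equiv> faces n X i"
abbreviation (input) "ver \<equiv> faces n X (i - 1)"
abbreviation (input) "cobd \<equiv> kernel_mat hor ver (\<lambda>f c. - orient i * inc c f)"
abbreviation (input) "bd \<equiv> kernel_mat ver hor (\<lambda>c f. - orient i * inc c f)"
abbreviation (input) "ud_mat \<equiv> kernel_mat hor hor (ud n X i)"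
abbreviation (input) "du_mat \<equiv> kernel_mat ver ver (du n X (i - 1))"

lemma cobd_bd: "cobd * bd = kernel_mat hor hor (du n X i)"
  unfolding kernel_mat_mult[OF distinct_faces]
  by (rule kernel_mat_cong) (simp add: du_def ac_simps)

lemma bd_cobd: "bd * cobd = kernel_mat ver ver (ud n X (i - 1))"
  unfolding kernel_mat_mult[OF distinct_faces]
  by (rule kernel_mat_cong) (simp add: ud_def ac_simps)

text \<open>
  The left factor of \<open>ud_mat\<close> is the boundary map from dimension \<open>i + 1\<close>, which the boundary map from
  dimension \<open>i\<close> annihilates.
\<close>
lemma bd_ud_mat:
  assumes X: "cubical_complex n X"
  shows "bd * ud_mat = 0\<^sub>m (length ver) (length hor)"
  unfolding kernel_mat_mult[OF distinct_faces] kernel_mat_zero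
proof (rule kernel_mat_cong)
  fix c g assume c: "c \<in> set ver"
  have "(\<Sum>f\<in>set hor. - orient i * inc c f * ud n X i f g)
      = (\<Sum>h\<in>set (faces n X (i + 1)). - orient i * inc g h * (\<Sum>f\<in>set hor. inc c f * inc f h))"
    unfolding ud_def sum_distrib_left by (subst sum.swap) (simp add: ac_simps)
  also have "\<dots> = 0"
    by (intro sum.neutral ballI) (simp add: sum_inc_inc_zero[OF X c])
  finally show "(\<Sum>f\<in>set hor. - orient i * inc c f * ud n X i f g) = 0" .
qed

text \<open>
  The transposed form of the same fact, one dimension lower.
\<close>
lemma cobd_du_mat:
  assumes X: "cubical_complex n X"
  shows "cobd * du_mat = 0\<^sub>m (length hor) (length ver)"
  unfolding kernel_mat_mult[OF distinct_faces] kernel_mat_zero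
proof (rule kernel_mat_cong)
  fix f c assume f: "f \<in> set hor"
  have "(\<Sum>c'\<in>set ver. - orient i * inc c' f * du n X (i - 1) c' c)
      = (\<Sum>b\<in>set (faces n X (i - 1 - 1)). - orient i * inc b c * (\<Sum>c'\<in>set ver. inc b c' * inc c' f))"
    unfolding du_def sum_distrib_left by (subst sum.swap) (simp add: ac_simps)
  also have "\<dots> = 0"
    by (intro sum.neutral ballI) (simp add: sum_inc_inc_zero[OF X _ f])
  finally show "(\<Sum>c'\<in>set ver. - orient i * inc c' f * du n X (i - 1) c' c) = 0" .
qed

text \<open>
  An exact form of the comparison of up-down spectra, for every \<open>i\<close>: the vertical faces account for
  additional zeros.
\<close>
lemma s_ud_prism:
  assumes X: "cubical_complex n X"
  shows "s_ud (Suc n) (prism n X) i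
    = s_ud n X i + image_mset (\<lambda>x. x + 2) (s_tot n X i) + replicate_mset (length ver) 0"
proof -
  let ?K = "ud (Suc n) (prism n X) i"
  have "kernel_mat hor hor (\<lambda>f g. ?K (f @ [Zero]) (g @ [Zero])) = ud_mat + 1\<^sub>m (length hor)"
    "kernel_mat hor hor (\<lambda>f g. ?K (f @ [One]) (g @ [One])) = ud_mat + 1\<^sub>m (length hor)"
    "kernel_mat hor hor (\<lambda>f g. ?K (f @ [Zero]) (g @ [One])) = - 1\<^sub>m (length hor)"
    "kernel_mat hor hor (\<lambda>f g. ?K (f @ [One]) (g @ [Zero])) = - 1\<^sub>m (length hor)"
    "kernel_mat hor ver (\<lambda>f c. ?K (f @ [Zero]) (c @ [Star])) = cobd"
    "kernel_mat hor ver (\<lambda>f c. ?K (f @ [One]) (c @ [Star])) = - cobd"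
    "kernel_mat ver hor (\<lambda>c f. ?K (c @ [Star]) (f @ [Zero])) = bd"
    "kernel_mat ver hor (\<lambda>c f. ?K (c @ [Star]) (f @ [One])) = - bd"
    "kernel_mat ver ver (\<lambda>c c'. ?K (c @ [Star]) (c' @ [Star])) = bd * cobd"
    unfolding bd_cobd kernel_mat_one[OF distinct_faces] kernel_mat_add kernel_mat_uminus
    by (rule kernel_mat_cong, simp only: ud_prism ud_prism_Star ud_prism_Star_Star)+
  then have "s_ud (Suc n) (prism n X) i = mset_spectrum ud_mat
      + image_mset (\<lambda>x. x + 2) (mset_spectrum (ud_mat + cobd * bd)) + replicate_mset (length ver) 0"
    unfolding s_ud_def eigenvalues_mset_spectrum L_ud_kernel_mat mset_spectrum_prism_kernel_mat
    by (simp only: mset_spectrum_ud_block[OF kernel_mat_carrier kernel_mat_carrier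
        kernel_mat_carrier bd_ud_mat[OF X]])
  then show ?thesis
    unfolding cobd_bd kernel_mat_add s_ud_def s_tot_def
      eigenvalues_mset_spectrum L_ud_kernel_mat L_tot_kernel_mat .
qed

lemma s_du_prism:
  assumes X: "cubical_complex n X"
  shows "s_du (Suc n) (prism n X) i
    = s_du n X i + image_mset (\<lambda>x. x + 2) (s_tot n X (i - 1)) + replicate_mset (length hor) 0"
proof -
  let ?K = "du (Suc n) (prism n X) i"
  have "kernel_mat hor hor (\<lambda>f g. ?K (f @ [Zero]) (g @ [Zero])) = cobd * bd"
    "kernel_mat hor hor (\<lambda>f g. ?K (f @ [One]) (g @ [One])) = cobd * bd"
    "kernel_mat hor hor (\<lambda>f g. ?K (f @ [Zero]) (g @ [One])) = 0\<^sub>m (length hor) (length hor)"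
    "kernel_mat hor hor (\<lambda>f g. ?K (f @ [One]) (g @ [Zero])) = 0\<^sub>m (length hor) (length hor)"
    "kernel_mat hor ver (\<lambda>f c. ?K (f @ [Zero]) (c @ [Star])) = - cobd"
    "kernel_mat hor ver (\<lambda>f c. ?K (f @ [One]) (c @ [Star])) = cobd"
    "kernel_mat ver hor (\<lambda>c f. ?K (c @ [Star]) (f @ [Zero])) = - bd"
    "kernel_mat ver hor (\<lambda>c f. ?K (c @ [Star]) (f @ [One])) = bd"
    "kernel_mat ver ver (\<lambda>c c'. ?K (c @ [Star]) (c' @ [Star])) = du_mat + 2 \<cdot>\<^sub>m 1\<^sub>m (length ver)"
    unfolding cobd_bd kernel_mat_scalar[OF distinct_faces] kernel_mat_add kernel_mat_uminus kernel_mat_zero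
    by (rule kernel_mat_cong, simp only: du_prism du_prism_Star du_prism_Star_Star)+
  then have "s_du (Suc n) (prism n X) i = mset_spectrum (cobd * bd)
      + image_mset (\<lambda>x. x + 2) (mset_spectrum (du_mat + bd * cobd)) + replicate_mset (length hor) 0"
    unfolding s_du_def eigenvalues_mset_spectrum L_du_kernel_mat mset_spectrum_prism_kernel_mat
    by (simp only: mset_spectrum_du_block[OF kernel_mat_carrier kernel_mat_carrier
        kernel_mat_carrier cobd_du_mat[OF X]])
  then show ?thesis
    unfolding cobd_bd bd_cobd kernel_mat_add s_du_def s_tot_def
      eigenvalues_mset_spectrum L_du_kernel_mat L_tot_kernel_mat
    by (simp only: add.commute)
qed

lemma s_tot_prism:
  "s_tot (Suc n) (prism n X) i
    = s_tot n X i + image_mset (\<lambda>x. x + 2) (s_tot n X i) + image_mset (\<lambda>x. x + 2) (s_tot n X (i - 1))"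
proof -
  let ?K = "\<lambda>f g. ud (Suc n) (prism n X) i f g + du (Suc n) (prism n X) i f g"
  let ?L = "kernel_mat hor hor (\<lambda>f g. ud n X i f g + du n X i f g)"
  let ?L' = "kernel_mat ver ver (\<lambda>f g. ud n X (i - 1) f g + du n X (i - 1) f g)"
  have "kernel_mat hor hor (\<lambda>f g. ?K (f @ [Zero]) (g @ [Zero])) = ?L + 1\<^sub>m (length hor)"
    "kernel_mat hor hor (\<lambda>f g. ?K (f @ [One]) (g @ [One])) = ?L + 1\<^sub>m (length hor)"
    "kernel_mat hor hor (\<lambda>f g. ?K (f @ [Zero]) (g @ [One])) = - 1\<^sub>m (length hor)"
    "kernel_mat hor hor (\<lambda>f g. ?K (f @ [One]) (g @ [Zero])) = - 1\<^sub>m (length hor)"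
    "kernel_mat hor ver (\<lambda>f c. ?K (f @ [Zero]) (c @ [Star])) = 0\<^sub>m (length hor) (length ver)"
    "kernel_mat hor ver (\<lambda>f c. ?K (f @ [One]) (c @ [Star])) = 0\<^sub>m (length hor) (length ver)"
    "kernel_mat ver hor (\<lambda>c f. ?K (c @ [Star]) (f @ [Zero])) = 0\<^sub>m (length ver) (length hor)"
    "kernel_mat ver hor (\<lambda>c f. ?K (c @ [Star]) (f @ [One])) = 0\<^sub>m (length ver) (length hor)"
    "kernel_mat ver ver (\<lambda>c c'. ?K (c @ [Star]) (c' @ [Star])) = ?L' + 2 \<cdot>\<^sub>m 1\<^sub>m (length ver)"
    unfolding kernel_mat_scalar[OF distinct_faces]
    unfolding kernel_mat_one[OF distinct_faces] kernel_mat_add kernel_mat_uminus kernel_mat_zero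
    by (rule kernel_mat_cong,
        simp add: ud_prism ud_prism_Star ud_prism_Star_Star du_prism du_prism_Star du_prism_Star_Star)+
  then show ?thesis
    unfolding s_tot_def eigenvalues_mset_spectrum L_tot_kernel_mat mset_spectrum_prism_kernel_mat
    by (simp only: mset_spectrum_tot_block[OF kernel_mat_carrier kernel_mat_carrier])
qed

end

section \<open>Generating functions and integrality\<close>

lemma rpow_add: "rpow (a + b) = rpow b * rpow a"
  by (simp add: rpow_def mult_single add.commute)

lemma sum_rpow_shift: "(\<Sum>x\<in>#image_mset (\<lambda>x. x + 2) M. rpow x) = rpow 2 * (\<Sum>x\<in>#M. rpow x)"
  by (induction M) (simp_all add: rpow_add algebra_simps)

lemma E_tot_prism:
  "E_tot (Suc n) (prism n X) i = (1 + rpow 2) * E_tot n X i + rpow 2 * E_tot n X (i - 1)"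
  unfolding E_tot_def s_tot_prism image_mset_union sum_mset.union sum_rpow_shift
  by (simp only: distrib_right mult_1_left)

lemma E_tot_no_faces:
  assumes "faces n X i = []"
  shows "E_tot n X i = 0"
proof -
  have "s_tot n X i = {#}"
    unfolding s_tot_def eigenvalues_mset_spectrum L_tot_kernel_mat assms kernel_mat_Nil
    by (simp add: mset_spectrum_zero_mat)
  then show ?thesis
    by (simp add: E_tot_def)
qed

text \<open>
  The formula holds for all \<open>k\<close>, since there are no faces and hence no eigenvalues above the dimension.
\<close>
lemma coeff_E_tot_poly:
  assumes "X \<subseteq> cube n"
  shows "coeff (E_tot_poly n X) k = E_tot n X (int k)"
proof -
  have "E_tot n X (int k) = 0" if "k > complex_dim X"
  proof (rule E_tot_no_faces)
    have "finite X"
      using assms finite_cube finite_subset by blast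
    then have le: "face_dim f \<le> complex_dim X" if "f \<in> X" for f
      using that by (simp add: complex_dim_def)
    have "f \<notin> set (faces n X (int k))" for f
      using le[of f] that by (auto simp: set_faces)
    then show "faces n X (int k) = []"
      by (metis last_in_set)
  qed
  then show ?thesis
    by (auto simp: E_tot_poly_def coeff_sum coeff_monom)
qed

lemma E_tot_poly_prism:
  assumes "X \<subseteq> cube n"
  shows "E_tot_poly (Suc n) (prism n X) =
    (1 + [:rpow 2:] + [:0, 1:] * [:rpow 2:]) * E_tot_poly n X"
proof (rule poly_eqI)
  fix k
  have "faces n X (- 1) = []"
    using set_faces[of n X "- 1"] by auto
  then have "E_tot n X (- 1) = 0"
    by (rule E_tot_no_faces)
  moreover have "coeff (E_tot_poly (Suc n) (prism n X)) k = E_tot (Suc n) (prism n X) (int k)"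
    by (rule coeff_E_tot_poly) (simp add: prism_def)
  ultimately show "coeff (E_tot_poly (Suc n) (prism n X)) k
      = coeff ((1 + [:rpow 2:] + [:0, 1:] * [:rpow 2:]) * E_tot_poly n X) k"
    by (cases k) (simp_all add: E_tot_prism coeff_E_tot_poly[OF assms] distrib_right)
qed

lemma laplacian_integral_prism:
  assumes X: "cubical_complex n X" and int: "laplacian_integral n X"
  shows "laplacian_integral (Suc n) (prism n X)"
  using int unfolding laplacian_integral_def s_ud_prism[OF X] s_du_prism[OF X] s_tot_prism
  by (auto split: if_splits)

theorem theorem3p3:
  fixes n d :: nat and X :: "face set"
  assumes X: "cubical_complex n X"
    and d: "complex_dim X = d"
  shows "E_tot_poly (Suc n) (prism n X) =
           (1 + [:rpow 2:] + [:0, 1:] * [:rpow 2:]) * E_tot_poly n X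
    \<and> (\<forall>i::int. 0 \<le> i \<and> i \<le> int d \<longrightarrow>
           E_tot (Suc n) (prism n X) i =
             (1 + rpow 2) * E_tot n X i + rpow 2 * E_tot n X (i - 1)
         \<and> s_tot (Suc n) (prism n X) i =
             s_tot n X i
             + {#x + 2. x \<in># s_tot n X i#}
             + {#y + 2. y \<in># s_tot n X (i - 1)#}
         \<and> s_ud (Suc n) (prism n X) i \<doteq>
             s_ud n X i + {#x + 2. x \<in># s_tot n X i#})
    \<and> (laplacian_integral n X \<longrightarrow> laplacian_integral (Suc n) (prism n X))"
proof (intro conjI allI impI)
  show "E_tot_poly (Suc n) (prism n X) =
      (1 + [:rpow 2:] + [:0, 1:] * [:rpow 2:]) * E_tot_poly n X"
    using X by (intro E_tot_poly_prism) (simp add: cubical_complex_def)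
  show "s_ud (Suc n) (prism n X) i \<doteq> s_ud n X i + {#x + 2. x \<in># s_tot n X i#}" for i
    by (simp add: eq_upto_zero_def s_ud_prism[OF X])
qed (simp_all add: E_tot_prism s_tot_prism laplacian_integral_prism[OF X])

end
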